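(* Let $d\ge2$, $S^d=\{x\in\mathbb{R}^d;\|x\|=1\}$ and $A_{d-1}=2\pi^{d/2}/\Gamma(d/2)$. For $0\le\rho<1$ and $\eta\in S^d$, let $\operatorname{Exit}_d(\rho\eta)$ denote the distribution on $S^d$ with density $\frac{1}{A_{d-1}}\frac{1-\rho^2}{\|x-\rho\eta\|^d}$ with respect to surface measure. Suppose $X\mid\xi\sim\operatorname{Exit}_d(\rho_1\xi)$ with known $\rho_1\in[0,1)$, and the prior distribution of $\xi\in S^d$ is $\operatorname{Exit}_d(\rho_2\eta_2)$ with $\rho_2\in[0,1)$, $\eta_2\in S^d$. Then for $\eta_1\in S^d$, the posterior distribution of $\xi$ given $X=\eta_1$ has density $$f(\xi)=\frac{1}{A_{d-1}}\frac{(1+\rho_1^2\rho_2^2-2\rho_1\rho_2\eta_1'\eta_2)^{d/2}}{1-\rho_1^2\rho_2^2}\frac{1-\rho_1^2}{\|\xi-\rho_1\eta_1\|^d}\frac{1-\rho_2^2}{\|\xi-\rho_2\eta_2\|^d},\qquad\xi\in S^d.$$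
   Context: In this paper $S^d$ denotes the unit sphere in $\mathbb{R}^d$. *)

theory Defs
  imports "HOL-Analysis.Analysis"
begin

definition sphere_area :: "nat \<Rightarrow> real" where
  "sphere_area d = 2 * pi powr (real d / 2) / Gamma (real d / 2)"

text \<open>Surface measure on the unit sphere S^d of a Euclidean space of dimension d,
  defined via the cone construction: sigma(B) = d * lambda({r x. 0 < r <= 1, x in B}).\<close>
definition surface_measure :: "'a::euclidean_space measure" where
  "surface_measure = measure_of (sphere 0 1) (sets (restrict_space borel (sphere 0 1)))
     (\<lambda>B. ennreal (real DIM('a)) *
            emeasure lborel {r *\<^sub>R x | r x. 0 < r \<and> r \<le> 1 \<and> x \<in> B})"

definition exit_density :: "real \<Rightarrow> 'a::euclidean_space \<Rightarrow> 'a \<Rightarrow> real" where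
  "exit_density \<rho> \<eta> x =
     (1 / sphere_area DIM('a)) * ((1 - \<rho>\<^sup>2) / norm (x - \<rho> *\<^sub>R \<eta>) ^ DIM('a))"

definition posterior_density ::
  "real \<Rightarrow> real \<Rightarrow> 'a::euclidean_space \<Rightarrow> 'a \<Rightarrow> 'a \<Rightarrow> real" where
  "posterior_density \<rho>\<^sub>1 \<rho>\<^sub>2 \<eta>\<^sub>2 \<eta>\<^sub>1 \<xi> =
     exit_density \<rho>\<^sub>1 \<xi> \<eta>\<^sub>1 * exit_density \<rho>\<^sub>2 \<eta>\<^sub>2 \<xi> /
     (\<integral>\<zeta>. exit_density \<rho>\<^sub>1 \<zeta> \<eta>\<^sub>1 * exit_density \<rho>\<^sub>2 \<eta>\<^sub>2 \<zeta> \<partial>surface_measure)"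

end

theory Submission
  imports Defs "HOL-Probability.Sinc_Integral"
begin

text \<open>
  Since \<open>\<parallel>\<eta>\<^sub>1 - \<rho>\<^sub>1 \<zeta>\<parallel> = \<parallel>\<zeta> - \<rho>\<^sub>1 \<eta>\<^sub>1\<parallel>\<close> on the sphere, only the normalising constant
  \<open>\<integral> \<parallel>\<zeta> - x\<parallel>\<^sup>-\<^sup>d \<parallel>\<zeta> - y\<parallel>\<^sup>-\<^sup>d d\<sigma>\<close> has to be evaluated. Put \<open>P = \<parallel>\<zeta> - x\<parallel>\<^sup>2 / (1 - \<parallel>x\<parallel>\<^sup>2)\<close> and
  \<open>Q = \<parallel>\<zeta> - y\<parallel>\<^sup>2 / (1 - \<parallel>y\<parallel>\<^sup>2)\<close>. Up to a constant depending only on \<open>d\<close>, Feynman's trick writes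
  \<open>(P Q) powr (- d / 2)\<close> as the integral over \<open>t \<in> \<real>\<close> of \<open>1 / (e\<^sup>t P + e\<^sup>-\<^sup>t Q)\<^sup>d\<close>, and on the sphere
  \<open>e\<^sup>t P + e\<^sup>-\<^sup>t Q\<close> is an affine function \<open>a - 2 b \<bullet> \<zeta>\<close>. In polar coordinates the sphere integral of
  \<open>(a - 2 b \<bullet> \<zeta>)\<^sup>-\<^sup>d\<close> is \<open>d\<close> times the volume of the ellipsoid \<open>a \<parallel>v\<parallel> \<le> 1 + 2 b \<bullet> v\<close>, and
  \<open>a\<^sup>2 - 4 \<parallel>b\<parallel>\<^sup>2 = 4 sinh\<^sup>2 t + K\<close> with \<open>K\<close> independent of \<open>t\<close>, so the remaining integral is elementary
  after \<open>w = sinh t\<close>. The constants depending on \<open>d\<close> are never computed: the case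
  \<open>x = y = 0\<close> determines the only ratio that matters.
\<close>

section \<open>Scaling of Lebesgue integrals, surface measure and polar coordinates\<close>

lemma nn_integral_lborel_affine:
  fixes f :: "'a::euclidean_space \<Rightarrow> ennreal"
  assumes [measurable]: "f \<in> borel_measurable borel" and c: "c \<noteq> 0"
  shows "(\<integral>\<^sup>+x. f x \<partial>lborel) = ennreal (\<bar>c\<bar> ^ DIM('a)) * (\<integral>\<^sup>+x. f (t + c *\<^sub>R x) \<partial>lborel)"
proof -
  have "(\<integral>\<^sup>+x. f x \<partial>lborel) =
      (\<integral>\<^sup>+x. f x \<partial>(density (distr lborel borel (\<lambda>x. t + c *\<^sub>R x)) (\<lambda>_. \<bar>c\<bar>^DIM('a))))"
    using c by (subst lborel_affine[of c t]) auto
  then show ?thesis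
    by (simp add: nn_integral_density nn_integral_distr nn_integral_cmult)
qed

lemma nn_integral_lborel_scaleR:
  fixes f :: "'a::euclidean_space \<Rightarrow> ennreal"
  assumes "f \<in> borel_measurable borel" and "c > 0"
  shows "(\<integral>\<^sup>+x. f x \<partial>lborel) = ennreal (c ^ DIM('a)) * (\<integral>\<^sup>+x. f (c *\<^sub>R x) \<partial>lborel)"
  using nn_integral_lborel_affine[of f c 0] assms by simp

lemma borel_measurable_sgn' [measurable]: "(sgn :: 'a::euclidean_space \<Rightarrow> 'a) \<in> borel_measurable borel"
  unfolding sgn_div_norm[abs_def] by measurable

text \<open>The cone over \<open>B\<close> in the definition is exactly the
  \<open>sgn\<close>-preimage of \<open>B\<close> in the punctured unit ball, so the set function is
  a scaled push-forward and hence a measure. The origin is removed because \<open>sgn 0 = 0\<close>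
  does not lie on the sphere.\<close>

lemma surface_measure_eq_distr:
  "(surface_measure :: 'a::euclidean_space measure) =
     scale_measure (real DIM('a))
       (distr (restrict_space lborel (cball 0 1 - {0})) (restrict_space borel (sphere 0 1)) sgn)"
  (is "_ = ?N")
proof -
  let ?S = "restrict_space borel (sphere 0 1) :: 'a measure"
  let ?B = "restrict_space lborel (cball 0 1 - {0}) :: 'a measure"
  have meas: "sgn \<in> ?B \<rightarrow>\<^sub>M ?S"
    by (intro measurable_restrict_space2 measurable_restrict_space1)
       (auto simp: space_restrict_space norm_sgn)
  have sp: "space ?N = sphere 0 1" "sets ?N = sets ?S"
    by (simp_all add: space_scale_measure space_restrict_space)
  have "surface_measure = measure_of (space ?N) (sets ?N) (emeasure ?N)"
    unfolding surface_measure_def sp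
  proof (rule measure_of_eq)
    show "sets ?S \<subseteq> Pow (sphere 0 1)"
      using sets.space_closed[of ?S] by (simp add: space_restrict_space)
  next
    fix B assume "B \<in> sigma_sets (sphere 0 1) (sets ?S)"
    then have B: "B \<in> sets ?S"
      using sets.sigma_sets_eq[of ?S] by (simp add: space_restrict_space)
    then have BS: "B \<subseteq> sphere 0 1"
      using sets.sets_into_space[of B ?S] by (simp add: space_restrict_space)
    have eq: "sgn -` B \<inter> space ?B = {r *\<^sub>R x | r x. 0 < r \<and> r \<le> 1 \<and> x \<in> B}"
    proof (intro equalityI subsetI)
      fix z assume "z \<in> sgn -` B \<inter> space ?B"
      then have "sgn z \<in> B" "norm z \<le> 1" "z \<noteq> 0"
        by (auto simp: space_restrict_space)
      moreover have "z = norm z *\<^sub>R sgn z" using \<open>z \<noteq> 0\<close> by (simp add: sgn_div_norm)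
      ultimately show "z \<in> {r *\<^sub>R x | r x. 0 < r \<and> r \<le> 1 \<and> x \<in> B}"
        using zero_less_norm_iff by blast
    next
      fix z assume "z \<in> {r *\<^sub>R x | r x. 0 < r \<and> r \<le> 1 \<and> x \<in> B}"
      then obtain r x where z: "z = r *\<^sub>R x" "0 < r" "r \<le> 1" "x \<in> B" by blast
      with BS have "norm x = 1" by auto
      with z show "z \<in> sgn -` B \<inter> space ?B"
        by (auto simp: space_restrict_space sgn_div_norm)
    qed
    have "sgn -` B \<inter> space ?B \<in> sets ?B" by (rule measurable_sets[OF meas B])
    then have "emeasure ?B (sgn -` B \<inter> space ?B) = emeasure lborel (sgn -` B \<inter> space ?B)"
      by (intro emeasure_restrict_space) (auto simp: space_restrict_space)
    then show "ennreal (real DIM('a)) * emeasure lborel {r *\<^sub>R x | r x. 0 < r \<and> r \<le> 1 \<and> x \<in> B}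
        = emeasure ?N B"
      using emeasure_distr[OF meas B] by (simp only: eq emeasure_scale_measure)
  qed
  then show ?thesis by (simp only: measure_of_of_measure)
qed

lemma sets_surface_measure:
  "sets (surface_measure :: 'a::euclidean_space measure) = sets (restrict_space borel (sphere 0 1))"
  by (simp add: surface_measure_eq_distr)

lemma space_surface_measure: "space surface_measure = sphere 0 1"
  by (simp add: surface_measure_eq_distr space_scale_measure space_restrict_space)

lemma measurable_surface_measure:
  assumes "f \<in> measurable borel M"
  shows "f \<in> measurable surface_measure M"
proof -
  have "f \<in> measurable (restrict_space borel (sphere 0 1)) M"
    using assms by (rule measurable_restrict_space1)
  then show ?thesis by (simp cong: measurable_cong_sets add: sets_surface_measure)
qed

lemma nn_integral_surface_measure:
  fixes f :: "'a::euclidean_space \<Rightarrow> ennreal"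
  assumes [measurable]: "f \<in> borel_measurable borel"
  shows "(\<integral>\<^sup>+x. f x \<partial>surface_measure) =
    real DIM('a) * (\<integral>\<^sup>+x. f (sgn x) * indicator (cball 0 1) x \<partial>lborel)"
proof -
  let ?S = "restrict_space borel (sphere 0 1) :: 'a measure"
  let ?B = "restrict_space lborel (cball 0 1 - {0}) :: 'a measure"
  have meas: "sgn \<in> ?B \<rightarrow>\<^sub>M ?S"
    by (intro measurable_restrict_space2 measurable_restrict_space1)
       (auto simp: space_restrict_space norm_sgn)
  have fS: "f \<in> borel_measurable ?S" by (intro measurable_restrict_space1) simp
  have "(\<integral>\<^sup>+x. f x \<partial>surface_measure) = real DIM('a) * (\<integral>\<^sup>+x. f (sgn x) \<partial>?B)"
    unfolding surface_measure_eq_distr using fS meas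
    by (subst nn_integral_scale_measure) (simp_all add: nn_integral_distr)
  also have "(\<integral>\<^sup>+x. f (sgn x) \<partial>?B) = (\<integral>\<^sup>+x. f (sgn x) * indicator (cball 0 1 - {0}) x \<partial>lborel)"
    by (subst nn_integral_restrict_space) auto
  \<comment> \<open>The origin is put back, as a Lebesgue null set, to get an integral over the full
    ball.\<close>
  also have "\<dots> = (\<integral>\<^sup>+x. f (sgn x) * indicator (cball 0 1) x \<partial>lborel)"
    by (rule nn_integral_cong_AE, rule AE_mp[OF AE_lborel_singleton[of 0]]) (auto simp: indicator_def)
  finally show ?thesis .
qed

text \<open>Both sides equal the integral of \<open>d / t\<close> over \<open>{(t, x). \<parallel>x\<parallel> \<le> t \<le> \<psi> (sgn x)}\<close>: substitute
  \<open>x = t x'\<close> for fixed \<open>t\<close>, respectively \<open>t = \<psi> (sgn x) s\<close> for fixed \<open>x\<close> and then \<open>x = s x'\<close>.\<close>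
lemma emeasure_radial_region:
  fixes \<psi> :: "'a::euclidean_space \<Rightarrow> real"
  assumes [measurable]: "\<psi> \<in> borel_measurable borel" and pos: "\<And>x. \<psi> x > 0"
  shows "emeasure lborel {x. norm x \<le> \<psi> (sgn x)} =
    (\<integral>\<^sup>+x. ennreal (\<psi> (sgn x) ^ DIM('a)) * indicator (cball 0 1) x \<partial>lborel)"
proof -
  define d where "d = DIM('a)"
  have d: "d > 0" by (simp add: d_def)
  \<comment> \<open>Scaling \<open>x\<close> by \<open>t\<close> produces the Jacobian
    \<open>t ^ d\<close>, and with the weight \<open>d / t\<close> this becomes
    \<open>d * t ^ (d - 1)\<close>, the derivative of \<open>t ^ d\<close>.\<close>
  define K where "K = (\<lambda>(t::real, x::'a).
    ennreal (d / t) * indicator {(t, x). 0 < t \<and> norm x \<le> t \<and> t \<le> \<psi> (sgn x)} (t, x))"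
  have Km[measurable]: "K \<in> borel_measurable (borel \<Otimes>\<^sub>M borel)"
    unfolding K_def by measurable
  have Km'[measurable]: "K \<in> borel_measurable (lborel \<Otimes>\<^sub>M lborel)"
    using Km by (simp cong: measurable_cong_sets)
  have power_int: "(\<integral>\<^sup>+t. ennreal (d * t ^ (d - 1)) * indicator {0..c} t \<partial>lborel) = ennreal (c ^ d)"
    if "c > 0" for c :: real
  proof -
    have "(\<integral>\<^sup>+t. ennreal (d * t ^ (d - 1)) * indicator {0..c} t \<partial>lborel) = ennreal (c ^ d - 0 ^ d)"
      using that by (intro nn_integral_FTC_Icc) (auto intro!: derivative_eq_intros)
    then show ?thesis using d by (simp add: zero_power)
  qed
  have sgn_scale: "sgn (t *\<^sub>R x) = sgn x" if "t > 0" for t and x :: 'a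
    using that by (simp add: sgn_scaleR)
  have "(\<integral>\<^sup>+x. ennreal (\<psi> (sgn x) ^ d) * indicator (cball 0 1) x \<partial>lborel) =
     (\<integral>\<^sup>+x. (\<integral>\<^sup>+t. ennreal (d * t ^ (d - 1)) * indicator {0..\<psi> (sgn x)} t * indicator (cball 0 1) x \<partial>lborel) \<partial>lborel)"
    by (subst nn_integral_multc) (auto simp: power_int pos simp del: One_nat_def)
  also have "\<dots> = (\<integral>\<^sup>+t. (\<integral>\<^sup>+x. ennreal (d * t ^ (d - 1)) * indicator {0..\<psi> (sgn x)} t * indicator (cball 0 1) x \<partial>lborel) \<partial>lborel)"
    by (rule lborel_pair.Fubini') (simp add: indicator_def[abs_def] split_beta')
  also have "\<dots> = (\<integral>\<^sup>+t. (\<integral>\<^sup>+x. K (t, x) \<partial>lborel) \<partial>lborel)"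
  \<comment> \<open>The point \<open>t = 0\<close> is discarded as a null set: in dimension one the
    left integrand does not vanish there (\<open>0 ^ 0 = 1\<close>), whereas \<open>K\<close>
    does.\<close>
  proof (rule nn_integral_cong_AE, rule AE_mp[OF AE_lborel_singleton[of 0]], rule AE_I2, rule impI)
    fix t :: real assume "t \<noteq> 0"
    show "(\<integral>\<^sup>+x. ennreal (d * t ^ (d - 1)) * indicator {0..\<psi> (sgn x)} t * indicator (cball 0 1) x \<partial>lborel)
      = (\<integral>\<^sup>+x. K (t, x) \<partial>lborel)"
    proof (cases "t > 0")
      case True
      have "(\<integral>\<^sup>+x. K (t, x) \<partial>lborel) = ennreal (t ^ d) * (\<integral>\<^sup>+x. K (t, t *\<^sub>R x) \<partial>lborel)"
        using True unfolding d_def by (intro nn_integral_lborel_scaleR) measurable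
      also have "\<dots> = (\<integral>\<^sup>+x. ennreal (t ^ d) * K (t, t *\<^sub>R x) \<partial>lborel)"
        by (rule nn_integral_cmult[symmetric]) measurable
      also have "\<dots> = (\<integral>\<^sup>+x. ennreal (d * t ^ (d - 1)) * indicator {0..\<psi> (sgn x)} t * indicator (cball 0 1) x \<partial>lborel)"
      proof (rule nn_integral_cong)
        fix x :: 'a
        have "t ^ d * (d / t) = d * t ^ (d - 1)"
          using True d by (cases d) auto
        then have "ennreal (t ^ d) * ennreal (d / t) = ennreal (d * t ^ (d - 1))"
          using True by (simp add: ennreal_mult[symmetric])
        then show "ennreal (t ^ d) * K (t, t *\<^sub>R x) =
          ennreal (d * t ^ (d - 1)) * indicator {0..\<psi> (sgn x)} t * indicator (cball 0 1) x"
          using True by (auto simp: K_def indicator_def sgn_scale)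
      qed
      finally show ?thesis by simp
    next
      case False
      with \<open>t \<noteq> 0\<close> show ?thesis by (intro nn_integral_cong) (auto simp: K_def)
    qed
  qed
  also have "\<dots> = (\<integral>\<^sup>+x. (\<integral>\<^sup>+t. K (t, x) \<partial>lborel) \<partial>lborel)"
    by (rule lborel_pair.Fubini') simp
  also have "\<dots> = (\<integral>\<^sup>+x. (\<integral>\<^sup>+s. ennreal (\<psi> (sgn x)) * K (\<psi> (sgn x) * s, x) \<partial>lborel) \<partial>lborel)"
  proof (rule nn_integral_cong)
    fix x :: 'a
    have "(\<integral>\<^sup>+t. K (t, x) \<partial>lborel) = ennreal \<bar>\<psi> (sgn x)\<bar> * (\<integral>\<^sup>+s. K (0 + \<psi> (sgn x) * s, x) \<partial>lborel)"
      using pos[of "sgn x"] by (intro nn_integral_real_affine) auto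
    then show "(\<integral>\<^sup>+t. K (t, x) \<partial>lborel) = (\<integral>\<^sup>+s. ennreal (\<psi> (sgn x)) * K (\<psi> (sgn x) * s, x) \<partial>lborel)"
      using pos[of "sgn x"] by (simp add: nn_integral_cmult)
  qed
  \<comment> \<open>With \<open>s\<close> outermost, \<open>x\<close> can be scaled by a fixed
    \<open>s\<close>. The factor \<open>\<psi>\<close> cancels against the one in
    \<open>d / (\<psi> * s)\<close>, and since \<open>sgn\<close> ignores positive factors the
    constraint \<open>norm x \<le> \<psi> * s\<close> becomes membership in the region
    itself.\<close>
  also have "\<dots> = (\<integral>\<^sup>+s. (\<integral>\<^sup>+x. ennreal (\<psi> (sgn x)) * K (\<psi> (sgn x) * s, x) \<partial>lborel) \<partial>lborel)"
    by (rule lborel_pair.Fubini') (simp add: split_beta')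
  also have "\<dots> = (\<integral>\<^sup>+s. ennreal (d * s ^ (d - 1)) * indicator {0..1} s * emeasure lborel {x. norm x \<le> \<psi> (sgn x)} \<partial>lborel)"
  proof (rule nn_integral_cong_AE, rule AE_mp[OF AE_lborel_singleton[of 0]], rule AE_I2, rule impI)
    fix s :: real assume "s \<noteq> 0"
    let ?E = "{x. norm x \<le> \<psi> (sgn x)}"
    have E[measurable]: "?E \<in> sets borel" by measurable
    show "(\<integral>\<^sup>+x. ennreal (\<psi> (sgn x)) * K (\<psi> (sgn x) * s, x) \<partial>lborel) =
      ennreal (d * s ^ (d - 1)) * indicator {0..1} s * emeasure lborel ?E"
    proof (cases "s > 0")
      case True
      have "(\<integral>\<^sup>+x. ennreal (\<psi> (sgn x)) * K (\<psi> (sgn x) * s, x) \<partial>lborel)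
        = ennreal (s ^ d) * (\<integral>\<^sup>+x. ennreal (\<psi> (sgn (s *\<^sub>R x))) * K (\<psi> (sgn (s *\<^sub>R x)) * s, s *\<^sub>R x) \<partial>lborel)"
        using True unfolding d_def by (intro nn_integral_lborel_scaleR) measurable
      also have "\<dots> = (\<integral>\<^sup>+x. ennreal (s ^ d) * (ennreal (\<psi> (sgn (s *\<^sub>R x))) * K (\<psi> (sgn (s *\<^sub>R x)) * s, s *\<^sub>R x)) \<partial>lborel)"
        by (rule nn_integral_cmult[symmetric]) measurable
      also have "\<dots> = (\<integral>\<^sup>+x. ennreal (d * s ^ (d - 1)) * indicator {0..1} s * indicator ?E x \<partial>lborel)"
      proof (rule nn_integral_cong)
        fix x :: 'a
        have p: "\<psi> (sgn x) > 0" by (rule pos)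
        have "s ^ d * (\<psi> (sgn x) * (d / (\<psi> (sgn x) * s))) = d * s ^ (d - 1)"
          using True d p by (cases d) auto
        then have "ennreal (s ^ d) * (ennreal (\<psi> (sgn x)) * ennreal (d / (\<psi> (sgn x) * s))) = ennreal (d * s ^ (d - 1))"
          using True p by (simp add: ennreal_mult[symmetric])
        then show "ennreal (s ^ d) * (ennreal (\<psi> (sgn (s *\<^sub>R x))) * K (\<psi> (sgn (s *\<^sub>R x)) * s, s *\<^sub>R x)) =
          ennreal (d * s ^ (d - 1)) * indicator {0..1} s * indicator ?E x"
          using True p by (auto simp: K_def indicator_def sgn_scale mult_less_0_iff zero_less_mult_iff)
      qed
      also have "\<dots> = ennreal (d * s ^ (d - 1)) * indicator {0..1} s * emeasure lborel ?E"
        by (subst nn_integral_cmult) auto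
      finally show ?thesis .
    next
      case False
      then have "\<psi> (sgn x) * s \<le> 0" for x :: 'a
        using pos[of "sgn x"] by (simp add: mult_le_0_iff)
      then have "K (\<psi> (sgn x) * s, x) = 0" for x
        by (auto simp: K_def not_less[symmetric])
      then show ?thesis using False \<open>s \<noteq> 0\<close> by simp
    qed
  qed
  also have "\<dots> = emeasure lborel {x. norm x \<le> \<psi> (sgn x)}"
    by (subst nn_integral_multc) (auto simp: power_int simp del: One_nat_def)
  finally show ?thesis by (simp add: d_def)
qed

section \<open>Orthogonal invariance, the volume of an ellipsoid and sphere integrals of affine
  powers\<close>

text \<open>The witness is the reflection in the hyperplane orthogonal to \<open>u - v\<close>. If
  \<open>u = v\<close>, then \<open>w = 0\<close> and the map is the identity.\<close>

lemma ex_orthogonal_transformation: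
  fixes u v :: "'a::euclidean_space"
  assumes "norm u = norm v"
  obtains R where "orthogonal_transformation R" "R u = v"
proof -
  define w where "w = u - v"
  define R where "R x = x - (2 * (x \<bullet> w) / (w \<bullet> w)) *\<^sub>R w" for x
  have lin: "linear R"
    by (rule linearI) (simp_all add: R_def inner_simps add_divide_distrib algebra_simps)
  have "norm (R x) = norm x" for x
  proof -
    have "R x \<bullet> R x = x \<bullet> x"
      by (cases "w = 0") (simp_all add: R_def inner_simps field_simps inner_commute)
    then show ?thesis by (simp add: norm_eq_sqrt_inner)
  qed
  with lin have R: "orthogonal_transformation R" by (simp add: orthogonal_transformation)
  \<comment> \<open>Equal norms force \<open>w \<bullet> w = 2 * (u \<bullet> w)\<close>, so for
    nonzero \<open>w\<close> the coefficient in \<open>R u\<close> is one and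
    \<open>R u = u - w = v\<close>.\<close>
  have "u \<bullet> u = v \<bullet> v" using assms by (simp add: norm_eq_sqrt_inner)
  then have "w \<bullet> w = 2 * (u \<bullet> w)"
    by (simp add: w_def inner_simps inner_commute)
  then have "R u = v"
    by (cases "w = 0") (auto simp: R_def, auto simp: w_def)
  with R show ?thesis by (rule that)
qed

text \<open>For Borel \<open>A\<close>, \<open>B\<close> and the image \<open>\<mu>\<close> of Lebesgue measure \<open>\<lambda>\<close>, computing
  \<open>\<integral>\<integral> 1\<^sub>A(R x) 1\<^sub>B(R x + y) dx dy\<close> in both orders gives \<open>\<mu>(A) \<lambda>(B) = \<mu>(B) \<lambda>(A)\<close>;
  take \<open>B\<close> to be the unit ball, on which \<open>\<mu>\<close> and \<open>\<lambda>\<close> agree.\<close>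
lemma lborel_distr_orthogonal_transformation:
  fixes R :: "'a::euclidean_space \<Rightarrow> 'a"
  assumes R: "orthogonal_transformation R"
  shows "distr lborel borel R = lborel"
proof (rule measure_eqI)
  fix A :: "'a set" assume "A \<in> sets (distr lborel borel R)"
  then have A[measurable]: "A \<in> sets borel" by simp
  let ?B = "cball 0 1 :: 'a set"
  have B[measurable]: "?B \<in> sets borel" by simp
  have lin: "linear R" and nrm: "norm (R x) = norm x" for x
    using R by (auto simp: orthogonal_transformation)
  have [measurable]: "R \<in> borel_measurable borel"
    using lin by (intro borel_measurable_continuous_onI linear_continuous_on linear_conv_bounded_linear[THEN iffD1])
  have surj: "surj R" using orthogonal_transformation_surj[OF R] .
  let ?\<mu> = "\<lambda>A. emeasure (distr lborel borel R) A"
  have mu: "?\<mu> C = (\<integral>\<^sup>+x. indicator C (R x) \<partial>lborel)" if "C \<in> sets borel" for C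
  proof -
    have "?\<mu> C = (\<integral>\<^sup>+x. indicator C x \<partial>distr lborel borel R)" using that by simp
    also have "\<dots> = (\<integral>\<^sup>+x. indicator C (R x) \<partial>lborel)" using that by (subst nn_integral_distr) auto
    finally show ?thesis .
  qed
  have "?\<mu> A * emeasure lborel ?B =
      (\<integral>\<^sup>+x. (\<integral>\<^sup>+y. indicator A (R x) * indicator ?B (R x + y) \<partial>lborel) \<partial>lborel)"
  proof -
    have "emeasure lborel ?B = (\<integral>\<^sup>+y. indicator ?B (R x + y) \<partial>lborel)" for x
      using nn_integral_lborel_affine[of "indicator ?B" 1 "R x"] by (simp add: borel_measurable_indicator)
    then have "(\<integral>\<^sup>+y. indicator A (R x) * indicator ?B (R x + y) \<partial>lborel) =
        indicator A (R x) * emeasure lborel ?B" for x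
      by (subst nn_integral_cmult) auto
    then show ?thesis by (simp add: mu nn_integral_multc)
  qed
  also have "\<dots> = (\<integral>\<^sup>+y. (\<integral>\<^sup>+x. indicator A (R x) * indicator ?B (R x + y) \<partial>lborel) \<partial>lborel)"
    by (rule lborel_pair.Fubini') (simp add: split_beta')
  also have "\<dots> = (\<integral>\<^sup>+y. (\<integral>\<^sup>+x. indicator A (R x - y) * indicator ?B (R x) \<partial>lborel) \<partial>lborel)"
  proof (rule nn_integral_cong)
    fix y
    \<comment> \<open>Surjectivity turns the shift by \<open>y\<close> into a translation of
      \<open>x\<close> by \<open>z\<close>, under which Lebesgue measure is invariant.\<close>
    obtain z where y: "y = R z" using surj by (metis surjD)
    show "(\<integral>\<^sup>+x. indicator A (R x) * indicator ?B (R x + y) \<partial>lborel) =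
       (\<integral>\<^sup>+x. indicator A (R x - y) * indicator ?B (R x) \<partial>lborel)"
      using nn_integral_lborel_affine[of "\<lambda>x. indicator A (R x - y) * indicator ?B (R x)" 1 z]
      by (simp add: y linear_add[OF lin] add.commute)
  qed
  also have "\<dots> = (\<integral>\<^sup>+x. (\<integral>\<^sup>+y. indicator A (R x - y) * indicator ?B (R x) \<partial>lborel) \<partial>lborel)"
    by (rule lborel_pair.Fubini') (simp add: split_beta')
  also have "\<dots> = emeasure lborel A * ?\<mu> ?B"
  proof -
    have "emeasure lborel A = (\<integral>\<^sup>+y. indicator A (R x - y) \<partial>lborel)" for x
      using nn_integral_lborel_affine[of "indicator A" "-1" "R x"] by (simp add: borel_measurable_indicator)
    then have "(\<integral>\<^sup>+y. indicator A (R x - y) * indicator ?B (R x) \<partial>lborel) =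
        emeasure lborel A * indicator ?B (R x)" for x
      by (subst nn_integral_multc) auto
    then show ?thesis by (simp add: mu nn_integral_cmult)
  qed
  also have "?\<mu> ?B = emeasure lborel ?B"
    by (subst mu) (auto simp: nrm indicator_def[abs_def] nn_integral_indicator[symmetric] simp del: nn_integral_indicator)
  finally have "?\<mu> A * emeasure lborel ?B = emeasure lborel A * emeasure lborel ?B" .
  \<comment> \<open>The volume of the unit ball is positive and finite, so it cancels.\<close>
  then show "?\<mu> A = emeasure lborel A"
    using less_imp_neq[OF unit_ball_vol_pos, of "real DIM('a)", THEN not_sym]
    by (subst (asm) (1 2) mult.commute)
       (auto simp: ennreal_mult_cancel_left emeasure_cball emeasure_lborel_cball_finite less_imp_neq)
qed simp

text \<open>The region is an ellipsoid with one focus at the origin.\<close>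
lemma emeasure_focal_ellipsoid:
  fixes b :: "'a::euclidean_space"
  assumes ab: "2 * norm b < a"
  shows "emeasure lborel {x. a * norm x \<le> 1 + 2 * (b \<bullet> x)} =
    ennreal (a * (a\<^sup>2 - 4 * (norm b)\<^sup>2) powr (- (real DIM('a) + 1) / 2)) *
    emeasure lborel (cball (0::'a) 1)"
proof -
  define \<beta> where "\<beta> = norm b"
  define m where "m = a\<^sup>2 - 4 * \<beta>\<^sup>2"
  have \<beta>: "\<beta> \<ge> 0" by (simp add: \<beta>_def)
  have a: "a > 0" "2 * \<beta> < a" using ab \<beta> unfolding \<beta>_def by linarith+
  have "(2 * \<beta>)\<^sup>2 < a\<^sup>2" using a \<beta> by (intro power_strict_mono) auto
  then have m: "m > 0" by (simp add: m_def power_mult_distrib)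
  \<comment> \<open>Rotating \<open>b\<close> onto a coordinate axis makes the ellipsoid
    axis-parallel.\<close>
  obtain i :: 'a where i: "i \<in> Basis" using nonempty_Basis by blast
  have "norm (\<beta> *\<^sub>R i) = norm b" using i by (simp add: \<beta>_def)
  then obtain R where R: "orthogonal_transformation R" "R (\<beta> *\<^sub>R i) = b"
    by (rule ex_orthogonal_transformation)
  have lin: "linear R" and nrm: "norm (R x) = norm x" for x
    using R by (auto simp: orthogonal_transformation)
  have [measurable]: "R \<in> borel_measurable borel"
    using lin by (intro borel_measurable_continuous_onI linear_continuous_on linear_conv_bounded_linear[THEN iffD1])
  have inn: "b \<bullet> R z = \<beta> * (z \<bullet> i)" for z
    using R by (metis orthogonal_transformation_def inner_scaleR_left inner_commute)
  let ?E = "{x. a * norm x \<le> 1 + 2 * (b \<bullet> x)}"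
  let ?F = "{z::'a. a * norm z \<le> 1 + 2 * \<beta> * (z \<bullet> i)}"
  have "emeasure lborel ?E = emeasure (distr lborel borel R) ?E"
    by (simp add: lborel_distr_orthogonal_transformation[OF R(1)])
  also have "\<dots> = emeasure lborel (R -` ?E)"
    by (subst emeasure_distr) auto
  also have "R -` ?E = ?F" by (auto simp: nrm inn)
  also have "emeasure lborel ?F = ennreal (a * m powr (- (real DIM('a) + 1) / 2)) * emeasure lborel (cball (0::'a) 1)"
  proof -
    \<comment> \<open>Completing the square in \<open>a\<^sup>2 * (norm z)\<^sup>2 \<le> (1 + 2 *
      \<beta> * (z \<bullet> i))\<^sup>2\<close> gives centre \<open>t\<close>, semi-axis
      \<open>a / m\<close> along \<open>i\<close> and semi-axes \<open>1 / sqrt m\<close> across it.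
      \<open>T\<close> maps the unit ball onto this ellipsoid, and the product of the
      \<open>c j\<close> is its Jacobian.\<close>
    define c where "c j = (if j = i then a / m else 1 / sqrt m)" for j
    define t where "t = (2 * \<beta> / m) *\<^sub>R i"
    define T where "T x = t + (\<Sum>j\<in>Basis. (c j * (x \<bullet> j)) *\<^sub>R j)" for x :: 'a
    have cpos: "c j > 0" for j using a m by (simp add: c_def)
    have [measurable]: "T \<in> borel_measurable borel" unfolding T_def by measurable
    have lb: "lborel = density (distr lborel borel T) (\<lambda>_. (\<Prod>j\<in>Basis. \<bar>c j\<bar>))"
      unfolding T_def using cpos by (intro lborel_affine_euclidean) (metis less_irrefl)
    have "(\<Prod>j\<in>Basis. \<bar>c j\<bar>) = (a / m) * (\<Prod>j\<in>Basis - {i::'a}. 1 / sqrt m)"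
      using i a m by (subst prod.remove[of _ i]) (auto simp: c_def)
    also have "\<dots> = a * m powr (- (real DIM('a) + 1) / 2)"
    proof -
      have "(1 / sqrt m) ^ (DIM('a) - 1) = (m powr (-1/2)) powr real (DIM('a) - 1)"
        using m by (subst powr_realpow) (auto simp: powr_half_sqrt powr_minus_divide)
      also have "\<dots> = m powr ((1 - real DIM('a)) / 2)"
        by (simp add: powr_powr of_nat_diff Suc_leI algebra_simps diff_divide_distrib)
      finally have "(a / m) * (1 / sqrt m) ^ (DIM('a) - 1) = a * (m powr (-1) * m powr ((1 - real DIM('a)) / 2))"
        using m by (simp add: powr_minus_divide)
      also have "m powr (-1) * m powr ((1 - real DIM('a)) / 2) = m powr (- (real DIM('a) + 1) / 2)"
        unfolding powr_add[symmetric] by (rule arg_cong) (simp add: field_simps)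
      finally show ?thesis using i by (simp add: card_Diff_singleton)
    qed
    finally have pr: "(\<Prod>j\<in>Basis. \<bar>c j\<bar>) = a * m powr (- (real DIM('a) + 1) / 2)" .
    have "T -` ?F = cball 0 1"
    proof (intro set_eqI)
      fix w :: 'a
      have Tj: "T w \<bullet> j = (if j = i then 2 * \<beta> / m + (a / m) * (w \<bullet> i) else (w \<bullet> j) / sqrt m)"
        if j: "j \<in> Basis" for j
        using i j by (auto simp: T_def t_def c_def inner_add_left inner_sum_left inner_Basis
            if_distrib[where f="\<lambda>x. _ * x"] cong: if_cong)
      define S where "S = (\<Sum>j\<in>Basis - {i}. (w \<bullet> j)\<^sup>2)"
      have nw: "(norm w)\<^sup>2 = (w \<bullet> i)\<^sup>2 + S"
        unfolding S_def power2_norm_eq_inner euclidean_inner[of w w] using i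
        by (subst sum.remove[of _ i]) (auto simp: power2_eq_square)
      have "(norm (T w))\<^sup>2 = (T w \<bullet> i)\<^sup>2 + (\<Sum>j\<in>Basis - {i}. (T w \<bullet> j)\<^sup>2)"
        unfolding power2_norm_eq_inner euclidean_inner[of "T w" "T w"] using i
        by (subst sum.remove[of _ i]) (auto simp: power2_eq_square)
      also have "(\<Sum>j\<in>Basis - {i}. (T w \<bullet> j)\<^sup>2) = S / m"
        using m unfolding S_def sum_divide_distrib by (intro sum.cong) (auto simp: Tj power_divide)
      finally have nT: "(norm (T w))\<^sup>2 = (T w \<bullet> i)\<^sup>2 + S / m" .
      define p where "p = T w \<bullet> i"
      have p: "p = 2 * \<beta> / m + (a / m) * (w \<bullet> i)" unfolding p_def using i by (simp add: Tj)
      have "\<bar>p\<bar> \<le> norm (T w)" unfolding p_def using i by (rule Basis_le_norm)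
      then have "2 * \<beta> * \<bar>p\<bar> \<le> 2 * \<beta> * norm (T w)" using \<beta> by (intro mult_left_mono) auto
      also have "\<dots> \<le> a * norm (T w)" using a by (intro mult_right_mono) auto
      finally have low: "2 * \<beta> * \<bar>p\<bar> \<le> a * norm (T w)" .
      have "2 * \<beta> * (- p) \<le> 2 * \<beta> * \<bar>p\<bar>" using \<beta> by (intro mult_left_mono) auto
      \<comment> \<open>This bound makes squaring an equivalence: if
        \<open>1 + 2 * \<beta> * p\<close> were negative, its absolute value would be less than
        \<open>- (2 * \<beta> * p)\<close>, hence less than \<open>a * norm (T w)\<close>, so both
        inequalities would fail.\<close>
      with low have low': "- (2 * \<beta> * p) \<le> a * norm (T w)" by simp
      have "T w \<in> ?F \<longleftrightarrow> a * norm (T w) \<le> 1 + 2 * \<beta> * p" by (simp add: p_def)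
      also have "\<dots> \<longleftrightarrow> (a * norm (T w))\<^sup>2 \<le> (1 + 2 * \<beta> * p)\<^sup>2"
        using low' a by (subst abs_le_square_iff[symmetric]) auto
      also have "\<dots> \<longleftrightarrow> a\<^sup>2 * (p\<^sup>2 + S / m) - (1 + 2 * \<beta> * p)\<^sup>2 \<le> 0"
        by (simp add: power_mult_distrib nT p_def)
      \<comment> \<open>After multiplication by \<open>m\<close>, the part in \<open>p\<close>
        becomes \<open>(m * p - 2 * \<beta>)\<^sup>2 - a\<^sup>2\<close>, and
        \<open>m * p - 2 * \<beta>\<close> is \<open>a * (w \<bullet> i)\<close>.\<close>
      also have "a\<^sup>2 * (p\<^sup>2 + S / m) - (1 + 2 * \<beta> * p)\<^sup>2 = a\<^sup>2 / m * ((norm w)\<^sup>2 - 1)"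
      proof -
        have mp: "m * p = 2 * \<beta> + a * (w \<bullet> i)" using m by (simp add: p field_simps)
        have a2: "a\<^sup>2 = m + 4 * \<beta>\<^sup>2" by (simp add: m_def)
        have "m * (a\<^sup>2 * (p\<^sup>2 + S / m) - (1 + 2 * \<beta> * p)\<^sup>2) = m * (a\<^sup>2 * p\<^sup>2 - (1 + 2 * \<beta> * p)\<^sup>2) + a\<^sup>2 * S"
          using m by (simp add: field_simps)
        also have "m * (a\<^sup>2 * p\<^sup>2 - (1 + 2 * \<beta> * p)\<^sup>2) = (m * p - 2 * \<beta>)\<^sup>2 - (m + 4 * \<beta>\<^sup>2)"
          unfolding a2 by (simp add: power2_eq_square algebra_simps)
        also have "\<dots> = a\<^sup>2 * (w \<bullet> i)\<^sup>2 - a\<^sup>2" by (simp add: mp a2[symmetric] power_mult_distrib)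
        also have "a\<^sup>2 * (w \<bullet> i)\<^sup>2 - a\<^sup>2 + a\<^sup>2 * S = a\<^sup>2 * ((norm w)\<^sup>2 - 1)"
          by (simp add: nw algebra_simps)
        finally have "a\<^sup>2 * (p\<^sup>2 + S / m) - (1 + 2 * \<beta> * p)\<^sup>2 = a\<^sup>2 * ((norm w)\<^sup>2 - 1) / m"
          using m by (metis less_irrefl nonzero_mult_div_cancel_left)
        then show ?thesis by simp
      qed
      also have "a\<^sup>2 / m * ((norm w)\<^sup>2 - 1) \<le> 0 \<longleftrightarrow> (norm w)\<^sup>2 \<le> 1\<^sup>2"
        using a m by (auto simp: mult_le_0_iff divide_le_0_iff zero_le_divide_iff not_less)
      also have "\<dots> \<longleftrightarrow> w \<in> cball 0 1"
        by (simp add: abs_square_le_1)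
      finally show "w \<in> T -` ?F \<longleftrightarrow> w \<in> cball 0 1" by simp
    qed
    moreover have "emeasure lborel ?F = (\<Prod>j\<in>Basis. \<bar>c j\<bar>) * emeasure lborel (T -` ?F)"
      by (subst lb, subst emeasure_density_const) (auto simp: emeasure_distr)
    ultimately show ?thesis by (simp only: pr)
  qed
  finally show ?thesis by (simp add: m_def \<beta>_def)
qed

text \<open>In polar coordinates the integrand is the \<open>d\<close>-th power of the radius
  function \<open>1 / (a - 2 * (b \<bullet> x))\<close>, whose region is the focal
  ellipsoid.\<close>

lemma nn_integral_surface_measure_affine:
  fixes b :: "'a::euclidean_space"
  assumes ab: "2 * norm b < a"
  shows "(\<integral>\<^sup>+x. ennreal (1 / (a - 2 * (b \<bullet> x)) ^ DIM('a)) \<partial>surface_measure) =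
    ennreal (sphere_area DIM('a) * (a * (a\<^sup>2 - 4 * (norm b)\<^sup>2) powr (- (real DIM('a) + 1) / 2)))"
proof -
  have a: "a > 0" using ab norm_ge_zero[of b] by linarith
  have pos: "a - 2 * (b \<bullet> x) > 0" if "norm x \<le> 1" for x
  proof -
    have "b \<bullet> x \<le> norm b * norm x" by (rule norm_cauchy_schwarz)
    also have "\<dots> \<le> norm b * 1" using that by (intro mult_left_mono) auto
    finally show ?thesis using ab by simp
  qed
  \<comment> \<open>The value 1 outside the unit ball only secures positivity everywhere;
    \<open>\<psi>\<close> is evaluated at points \<open>sgn x\<close>, which have norm at most
    one.\<close>
  define \<psi> where "\<psi> x = (if norm x \<le> 1 then 1 / (a - 2 * (b \<bullet> x)) else 1)" for x
  have \<psi>m[measurable]: "\<psi> \<in> borel_measurable borel" unfolding \<psi>_def by measurable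
  have \<psi>p: "\<psi> x > 0" for x using pos by (auto simp: \<psi>_def)
  have ns: "norm (sgn x) \<le> 1" for x :: 'a by (simp add: norm_sgn)
  have "(\<integral>\<^sup>+x. ennreal (1 / (a - 2 * (b \<bullet> x)) ^ DIM('a)) \<partial>surface_measure) =
    real DIM('a) * (\<integral>\<^sup>+x. ennreal (1 / (a - 2 * (b \<bullet> sgn x)) ^ DIM('a)) * indicator (cball 0 1) x \<partial>lborel)"
    by (rule nn_integral_surface_measure) measurable
  also have "(\<integral>\<^sup>+x. ennreal (1 / (a - 2 * (b \<bullet> sgn x)) ^ DIM('a)) * indicator (cball 0 1) x \<partial>lborel)
    = emeasure lborel {x. norm x \<le> \<psi> (sgn x)}"
    by (subst emeasure_radial_region[OF \<psi>m \<psi>p]) (simp add: \<psi>_def ns power_one_over)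
  also have "{x. norm x \<le> \<psi> (sgn x)} = {x. a * norm x \<le> 1 + 2 * (b \<bullet> x)}"
  proof (intro Collect_cong)
    fix x :: 'a
    have "norm x \<le> \<psi> (sgn x) \<longleftrightarrow> norm x * (a - 2 * (b \<bullet> sgn x)) \<le> 1"
      using pos[OF ns] by (simp add: \<psi>_def ns pos_le_divide_eq)
    also have "norm x * (a - 2 * (b \<bullet> sgn x)) = a * norm x - 2 * (b \<bullet> x)"
      by (cases "x = 0") (simp_all add: sgn_div_norm field_simps)
    finally show "norm x \<le> \<psi> (sgn x) \<longleftrightarrow> a * norm x \<le> 1 + 2 * (b \<bullet> x)" by auto
  qed
  also have "emeasure lborel \<dots> = 
    ennreal (a * (a\<^sup>2 - 4 * (norm b)\<^sup>2) powr (- (real DIM('a) + 1) / 2)) * ennreal (unit_ball_vol DIM('a))"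
    by (subst emeasure_focal_ellipsoid[OF ab]) (simp add: emeasure_cball)
  also have "real DIM('a) * (ennreal (a * (a\<^sup>2 - 4 * (norm b)\<^sup>2) powr (- (real DIM('a) + 1) / 2)) * ennreal (unit_ball_vol DIM('a)))
    = ennreal (real DIM('a) * unit_ball_vol DIM('a) * (a * (a\<^sup>2 - 4 * (norm b)\<^sup>2) powr (- (real DIM('a) + 1) / 2)))"
    using a by (simp add: ennreal_mult' mult_ac)
  \<comment> \<open>The recurrence for \<open>Gamma\<close> at \<open>d / 2\<close> links the volume
    of the ball to the area of the sphere.\<close>
  also have "real DIM('a) * unit_ball_vol DIM('a) = sphere_area DIM('a)"
  proof -
    have "real DIM('a) / 2 > 0" by simp
    then have "real DIM('a) / 2 \<notin> \<int>\<^sub>\<le>\<^sub>0" using nonpos_Ints_nonpos by fastforce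
    then have "Gamma (real DIM('a) / 2 + 1) = real DIM('a) / 2 * Gamma (real DIM('a) / 2)"
      by (rule Gamma_plus1)
    then have "real DIM('a) * unit_ball_vol DIM('a) = real DIM('a) * pi powr (real DIM('a) / 2) /
        (real DIM('a) / 2 * Gamma (real DIM('a) / 2))"
      by (simp only: unit_ball_vol_def times_divide_eq_right)
    then show ?thesis by (simp add: sphere_area_def)
  qed
  finally show ?thesis .
qed

section \<open>One-dimensional integrals: the substitution \<open>w = sinh t\<close>, Feynman's
  trick and the integral over \<open>t\<close>\<close>

text \<open>The line is exhausted by compact intervals; substitution is applied on each of them and
  monotone convergence gives the limit.\<close>

lemma nn_integral_sinh_substitution:
  fixes f :: "real \<Rightarrow> ennreal"
  assumes [measurable]: "f \<in> borel_measurable borel"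
  shows "(\<integral>\<^sup>+w. f w \<partial>lborel) = (\<integral>\<^sup>+t. f (sinh t) * ennreal (cosh t) \<partial>lborel)"
proof -
  have [measurable]: "sinh \<in> borel_measurable (borel :: real measure)"
       "cosh \<in> borel_measurable (borel :: real measure)"
    by (auto intro!: borel_measurable_continuous_onI continuous_intros)
  \<comment> \<open>One exhaustion statement serves both sides: \<open>u\<close> is
    \<open>sinh\<close> on the left and the identity on the right.\<close>
  have conv: "(\<integral>\<^sup>+x. g x \<partial>lborel) = (SUP n::nat. \<integral>\<^sup>+x. g x * indicator {u (- real n)..u (real n)} x \<partial>lborel)"
    if [measurable]: "g \<in> borel_measurable borel" and u: "mono u" "filterlim u at_top at_top" "filterlim u at_bot at_bot"
    for g :: "real \<Rightarrow> ennreal" and u :: "real \<Rightarrow> real"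
  proof -
    have "(SUP n::nat. g x * indicator {u (- real n)..u (real n)} x) = g x" for x
    proof (rule antisym)
      show "(SUP n::nat. g x * indicator {u (- real n)..u (real n)} x) \<le> g x"
        by (rule SUP_least) (auto simp: indicator_def)
      obtain N where N: "\<And>n. n \<ge> N \<Longrightarrow> u n \<ge> x"
        using u(2) unfolding filterlim_at_top eventually_at_top_linorder by blast
      obtain M where M: "\<And>n. n \<le> M \<Longrightarrow> u n \<le> x"
        using u(3) unfolding filterlim_at_bot eventually_at_bot_linorder by blast
      define n where "n = nat \<lceil>max N (- M)\<rceil>"
      have "real n \<ge> N" "- real n \<le> M" unfolding n_def by linarith+
      then have "g x = g x * indicator {u (- real n)..u (real n)} x"
        using N M by (auto simp: indicator_def)
      also have "\<dots> \<le> (SUP n::nat. g x * indicator {u (- real n)..u (real n)} x)"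
        by (rule SUP_upper) simp
      finally show "g x \<le> (SUP n::nat. g x * indicator {u (- real n)..u (real n)} x)" .
    qed
    then have "(\<integral>\<^sup>+x. g x \<partial>lborel) = (\<integral>\<^sup>+x. (SUP n::nat. g x * indicator {u (- real n)..u (real n)} x) \<partial>lborel)"
      by simp
    also have "\<dots> = (SUP n::nat. \<integral>\<^sup>+x. g x * indicator {u (- real n)..u (real n)} x \<partial>lborel)"
    proof (rule nn_integral_monotone_convergence_SUP)
      show "incseq (\<lambda>(n::nat) x. g x * indicator {u (- real n)..u (real n)} x)"
      proof (rule incseq_SucI, rule le_funI)
        fix n :: nat and x
        have "u (real n) \<le> u (real (Suc n))" "u (- real (Suc n)) \<le> u (- real n)"
          using u(1) by (auto intro: monoD)
        then show "g x * indicator {u (- real n)..u (real n)} x \<le> g x * indicator {u (- real (Suc n))..u (real (Suc n))} x"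
          by (auto simp: indicator_def)
      qed
    qed measurable
    finally show ?thesis .
  qed
  have sinh: "mono (sinh :: real \<Rightarrow> real)" by (simp add: mono_def)
  have "(\<integral>\<^sup>+w. f w \<partial>lborel) = (SUP n::nat. \<integral>\<^sup>+x. f x * indicator {sinh (- real n)..sinh (real n)} x \<partial>lborel)"
    by (rule conv) (auto intro: sinh sinh_real_at_top sinh_real_at_bot)
  also have "\<dots> = (SUP n::nat. \<integral>\<^sup>+t. f (sinh t) * ennreal (cosh t) * indicator {- real n..real n} t \<partial>lborel)"
  proof (rule SUP_cong[OF refl])
    fix n :: nat
    show "(\<integral>\<^sup>+x. f x * indicator {sinh (- real n)..sinh (real n)} x \<partial>lborel) =
      (\<integral>\<^sup>+t. f (sinh t) * ennreal (cosh t) * indicator {- real n..real n} t \<partial>lborel)"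
    \<comment> \<open>For \<open>n = 0\<close> both intervals shrink to the null set
      \<open>{0}\<close>; the substitution rule is used on nondegenerate intervals.\<close>
    proof (cases "n = 0")
      case True
      have "(\<integral>\<^sup>+x. g x * indicator {0} x \<partial>lborel) = 0" for g :: "real \<Rightarrow> ennreal"
      proof -
        have "(\<integral>\<^sup>+x. g x * indicator {0} x \<partial>lborel) = (\<integral>\<^sup>+(x::real). 0 \<partial>lborel)"
          by (rule nn_integral_cong_AE, rule AE_mp[OF AE_lborel_singleton[of 0]]) auto
        then show ?thesis by simp
      qed
      then show ?thesis using True by simp
    next
      case False
      then show ?thesis
        by (intro nn_integral_substitution_aux)
           (auto intro!: derivative_eq_intros continuous_intros)
    qed
  qed
  also have "\<dots> = (\<integral>\<^sup>+t. f (sinh t) * ennreal (cosh t) \<partial>lborel)"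
    by (subst conv[of _ "\<lambda>x. x"]) (auto simp: mono_def filterlim_ident)
  finally show ?thesis .
qed

text \<open>For positive \<open>d\<close> this is half the Beta function at
  \<open>(d / 2, d / 2)\<close>. Only its being positive and finite is used, so that it can be
  cancelled.\<close>

definition feynman_const :: "nat \<Rightarrow> ennreal" where
  "feynman_const d = (\<integral>\<^sup>+t. ennreal (1 / (exp t + exp (-t)) ^ d) \<partial>lborel)"

text \<open>The quadratic Taylor bound for \<open>exp \<bar>t\<bar>\<close> shows that
  \<open>exp t + exp (-t)\<close> is at least 1 and at least \<open>(1 + t\<^sup>2) / 2\<close>.
  Raising it to a positive power keeps the latter bound, so a multiple of the integrable
  \<open>1 / (1 + t\<^sup>2)\<close> dominates.\<close>

lemma feynman_const_finite:
  assumes "d > 0"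
  shows "feynman_const d < \<infinity>"
proof -
  have le: "1 / (exp t + exp (-t)) ^ d \<le> 2 * inverse (1 + t\<^sup>2)" for t :: real
  proof -
    have "1 + \<bar>t\<bar> + \<bar>t\<bar>\<^sup>2 / 2 \<le> exp \<bar>t\<bar>" by (rule exp_lower_Taylor_quadratic) simp
    also have "exp \<bar>t\<bar> \<le> exp t + exp (-t)" by (simp add: abs_if)
    finally have *: "1 + \<bar>t\<bar> + t\<^sup>2 / 2 \<le> exp t + exp (-t)" by simp
    have t2: "1 + t\<^sup>2 > 0" using zero_le_power2[of t] by linarith
    have "1 \<le> exp t + exp (-t)" using * zero_le_power2[of t] by linarith
    then have "(exp t + exp (-t)) ^ 1 \<le> (exp t + exp (-t)) ^ d"
      using assms by (intro power_increasing) auto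
    then have "(1 + t\<^sup>2) / 2 \<le> (exp t + exp (-t)) ^ d" using * by simp
    then have "1 / (exp t + exp (-t)) ^ d \<le> 1 / ((1 + t\<^sup>2) / 2)"
      using t2 by (intro divide_left_mono mult_pos_pos zero_less_power add_pos_pos) auto
    then show ?thesis by (simp add: inverse_eq_divide)
  qed
  have "integrable lborel (\<lambda>t::real. 2 * inverse (1 + t\<^sup>2))"
    using integrable_inverse_1_plus_square by (simp add: set_integrable_def)
  then have "(\<integral>\<^sup>+t. ennreal (2 * inverse (1 + t\<^sup>2)) \<partial>(lborel :: real measure)) < \<infinity>"
    by (subst (asm) integrable_iff_bounded) (auto simp: abs_mult)
  moreover have "feynman_const d \<le> (\<integral>\<^sup>+t. ennreal (2 * inverse (1 + t\<^sup>2)) \<partial>(lborel :: real measure))"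
    unfolding feynman_const_def by (intro nn_integral_mono ennreal_leI le)
  ultimately show ?thesis by (rule le_less_trans[rotated])
qed

lemma feynman_const_pos: "feynman_const d > 0"
proof -
  have "feynman_const d \<noteq> 0"
  proof
    assume "feynman_const d = 0"
    then have "AE t in lborel. ennreal (1 / (exp t + exp (- t :: real)) ^ d) = 0"
      unfolding feynman_const_def by (subst (asm) nn_integral_0_iff_AE) auto
    moreover have "1 / (exp t + exp (- t :: real)) ^ d > 0" for t
      by (intro divide_pos_pos zero_less_power add_pos_pos) auto
    ultimately have "AE t in (lborel :: real measure). False"
      by (auto simp: ennreal_eq_0_iff not_le[symmetric])
    then show False by (simp add: AE_iff_null null_sets_def)
  qed
  then show ?thesis by (simp add: zero_less_iff_neq_zero)
qed

text \<open>Shift \<open>t\<close> by the \<open>c\<close> that balances the two terms,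
  \<open>exp c * P = exp (-c) * Q\<close>. Both then equal \<open>sqrt (P * Q)\<close>, which
  factors out.\<close>

lemma nn_integral_feynman:
  assumes P: "P > 0" and Q: "Q > 0"
  shows "(\<integral>\<^sup>+t. ennreal (1 / (exp t * P + exp (-t) * Q) ^ d) \<partial>lborel) =
    ennreal ((P * Q) powr (- real d / 2)) * feynman_const d"
proof -
  define c where "c = ln (Q / P) / 2"
  have esqrt: "exp (ln z / 2) = sqrt z" if "z > 0" for z :: real
    using that by (simp add: ln_sqrt[symmetric])
  have mc: "- c = ln (P / Q) / 2" using P Q by (simp add: c_def ln_div diff_divide_distrib)
  have ec: "exp c = sqrt (Q / P)" "exp (-c) = sqrt (P / Q)"
    using P Q unfolding mc unfolding c_def by (simp_all only: esqrt divide_pos_pos)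
  have sq: "sqrt (Q / P) * P = sqrt (P * Q)" "sqrt (P / Q) * Q = sqrt (P * Q)"
    using P Q by (auto intro!: real_sqrt_unique[symmetric] simp: power_mult_distrib)
      (auto simp: power2_eq_square)
  have eP: "exp (c + t) * P = sqrt (P * Q) * exp t" for t
  proof -
    have "exp (c + t) * P = (exp c * P) * exp t" by (simp add: exp_add)
    then show ?thesis by (simp only: ec sq)
  qed
  have eQ: "exp (- (c + t)) * Q = sqrt (P * Q) * exp (-t)" for t
  proof -
    have "exp (- (c + t)) * Q = (exp (-c) * Q) * exp (-t)"
      unfolding minus_add_distrib exp_add by (simp only: mult_ac)
    then show ?thesis by (simp only: ec sq)
  qed
  have pw: "sqrt (P * Q) ^ d = (P * Q) powr (real d / 2)"
    using P Q by (simp add: powr_half_sqrt[symmetric] powr_realpow[symmetric] powr_powr)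
  have "(\<integral>\<^sup>+t. ennreal (1 / (exp t * P + exp (-t) * Q) ^ d) \<partial>lborel) =
    (\<integral>\<^sup>+t. ennreal (1 / (exp (c + t) * P + exp (-(c + t)) * Q) ^ d) \<partial>lborel)"
    by (subst nn_integral_real_affine[where c=1 and t=c]) auto
  also have "\<dots> = (\<integral>\<^sup>+t. ennreal ((P * Q) powr (- real d / 2)) * ennreal (1 / (exp t + exp (-t)) ^ d) \<partial>lborel)"
  proof (rule nn_integral_cong)
    fix t :: real
    have "(exp (c + t) * P + exp (-(c + t)) * Q) ^ d = (P * Q) powr (real d / 2) * (exp t + exp (-t)) ^ d"
      unfolding eP eQ distrib_left[symmetric] power_mult_distrib pw ..
    then show "ennreal (1 / (exp (c + t) * P + exp (-(c + t)) * Q) ^ d) =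
      ennreal ((P * Q) powr (- real d / 2)) * ennreal (1 / (exp t + exp (-t)) ^ d)"
      by (subst ennreal_mult[symmetric]) (auto simp: powr_minus_divide)
  qed
  also have "\<dots> = ennreal ((P * Q) powr (- real d / 2)) * feynman_const d"
    unfolding feynman_const_def by (rule nn_integral_cmult) measurable
  finally show ?thesis .
qed

text \<open>Rewriting the surface integral over the ball reduces the exchange to Fubini for two
  Lebesgue measures.\<close>

lemma nn_integral_surface_measure_swap:
  fixes f :: "real \<Rightarrow> 'a::euclidean_space \<Rightarrow> ennreal"
  assumes [measurable]: "case_prod f \<in> borel_measurable (borel \<Otimes>\<^sub>M borel)"
  shows "(\<integral>\<^sup>+x. (\<integral>\<^sup>+t. f t x \<partial>lborel) \<partial>surface_measure) = (\<integral>\<^sup>+t. (\<integral>\<^sup>+x. f t x \<partial>surface_measure) \<partial>lborel)"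
proof -
  have m[measurable]: "(\<lambda>z. f (fst z) (snd z)) \<in> borel_measurable (borel \<Otimes>\<^sub>M borel)"
    using assms by (simp add: split_beta')
  have "(\<lambda>z. f (fst z) (sgn (snd z))) \<in> borel_measurable (borel \<Otimes>\<^sub>M borel)"
    using measurable_compose[OF _ m, of "\<lambda>z. (fst z, sgn (snd z))"] by simp
  then have m': "(\<lambda>z. f (fst z) (sgn (snd z))) \<in> borel_measurable (lborel \<Otimes>\<^sub>M lborel)"
    by (simp cong: measurable_cong_sets)
  have [measurable]: "cball 0 1 \<in> sets (borel :: 'a measure)" by simp
  have m'': "(\<lambda>z. f (fst z) (sgn (snd z)) * indicator (cball 0 1) (snd z)) \<in> borel_measurable (lborel \<Otimes>\<^sub>M lborel)"
    by (rule borel_measurable_times_ennreal[OF m']) measurable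
  have "(\<integral>\<^sup>+x. (\<integral>\<^sup>+t. f t x \<partial>lborel) \<partial>surface_measure) =
     real DIM('a) * (\<integral>\<^sup>+x. (\<integral>\<^sup>+t. f t (sgn x) \<partial>lborel) * indicator (cball 0 1) x \<partial>lborel)"
    by (intro nn_integral_surface_measure) measurable
  also have "\<dots> = real DIM('a) * (\<integral>\<^sup>+x. (\<integral>\<^sup>+t. f t (sgn x) * indicator (cball 0 1) x \<partial>lborel) \<partial>lborel)"
    by (subst nn_integral_multc) auto
  also have "(\<integral>\<^sup>+x. (\<integral>\<^sup>+t. f t (sgn x) * indicator (cball 0 1) x \<partial>lborel) \<partial>lborel) =
    (\<integral>\<^sup>+t. (\<integral>\<^sup>+x. f t (sgn x) * indicator (cball 0 1) x \<partial>lborel) \<partial>lborel)"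
    by (rule lborel_pair.Fubini') (use m'' in \<open>simp add: split_beta'\<close>)
  also have "real DIM('a) * \<dots> = (\<integral>\<^sup>+t. real DIM('a) * (\<integral>\<^sup>+x. f t (sgn x) * indicator (cball 0 1) x \<partial>lborel) \<partial>lborel)"
    by (rule nn_integral_cmult[symmetric]) measurable
  also have "\<dots> = (\<integral>\<^sup>+t. (\<integral>\<^sup>+x. f t x \<partial>surface_measure) \<partial>lborel)"
    by (subst nn_integral_surface_measure) auto
  finally show ?thesis .
qed

text \<open>The factor left after substituting \<open>w = sinh t\<close> and scaling
  \<open>K\<close> out of the \<open>t\<close>-integral.\<close>

definition sinh_const :: "nat \<Rightarrow> ennreal" where
  "sinh_const d = (\<integral>\<^sup>+w. ennreal ((1 + 4 * w\<^sup>2) powr (- (real d + 1) / 2)) \<partial>lborel)"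

text \<open>The power is even in \<open>t\<close>, so \<open>exp t\<close> and
  \<open>exp (-t)\<close> have the same integral against it and may both be replaced by
  \<open>cosh t\<close>, the derivative of \<open>sinh t\<close>. Scaling \<open>w\<close> by
  \<open>sqrt K\<close> then gives the exponent \<open>1 / 2 - (d + 1) / 2 = - d / 2\<close> of
  \<open>K\<close>.\<close>

lemma nn_integral_exp_sinh_powr:
  assumes K: "K > 0" and \<alpha>: "\<alpha> \<ge> 0" and \<beta>: "\<beta> \<ge> 0"
  shows "(\<integral>\<^sup>+t. ennreal ((\<alpha> * exp t + \<beta> * exp (-t)) * (4 * (sinh t)\<^sup>2 + K) powr (- (real d + 1) / 2)) \<partial>lborel) =
    ennreal ((\<alpha> + \<beta>) * K powr (- real d / 2)) * sinh_const d"
proof -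
  have [measurable]: "sinh \<in> borel_measurable (borel :: real measure)"
       "cosh \<in> borel_measurable (borel :: real measure)"
    by (auto intro!: borel_measurable_continuous_onI continuous_intros)
  define \<phi> where "\<phi> t = (4 * (sinh t)\<^sup>2 + K) powr (- (real d + 1) / 2)" for t :: real
  have [measurable]: "\<phi> \<in> borel_measurable borel" unfolding \<phi>_def by measurable
  have \<phi>: "\<phi> t \<ge> 0" "\<phi> (-t) = \<phi> t" for t by (simp_all add: \<phi>_def)
  define E where "E = (\<integral>\<^sup>+t. ennreal (exp t * \<phi> t) \<partial>lborel)"
  have E': "(\<integral>\<^sup>+t. ennreal (exp (-t) * \<phi> t) \<partial>lborel) = E"
    unfolding E_def by (subst nn_integral_real_affine[where c="-1" and t=0]) (auto simp: \<phi>)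
  have lin: "(\<integral>\<^sup>+t. ennreal ((\<alpha> * exp t + \<beta> * exp (-t)) * \<phi> t) \<partial>lborel) = ennreal (\<alpha> + \<beta>) * E"
    if "\<alpha> \<ge> 0" "\<beta> \<ge> 0" for \<alpha> \<beta> :: real
  proof -
    have "(\<integral>\<^sup>+t. ennreal ((\<alpha> * exp t + \<beta> * exp (-t)) * \<phi> t) \<partial>lborel) =
      (\<integral>\<^sup>+t. ennreal \<alpha> * ennreal (exp t * \<phi> t) + ennreal \<beta> * ennreal (exp (-t) * \<phi> t) \<partial>lborel)"
      using that \<phi>(1) by (intro nn_integral_cong)
         (simp add: ennreal_mult[symmetric] ennreal_plus[symmetric] distrib_right mult.assoc del: ennreal_plus)
    also have "\<dots> = ennreal \<alpha> * E + ennreal \<beta> * E"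
      by (subst nn_integral_add) (auto simp: nn_integral_cmult E_def[symmetric] E')
    also have "\<dots> = ennreal (\<alpha> + \<beta>) * E" using that by (simp add: distrib_right)
    finally show ?thesis .
  qed
  \<comment> \<open>Both weights are taken to be one half, which turns the combination into
    \<open>cosh t\<close>.\<close>
  have "E = (\<integral>\<^sup>+t. ennreal ((4 * (sinh t)\<^sup>2 + K) powr (- (real d + 1) / 2)) * ennreal (cosh t) \<partial>lborel)"
    using lin[of "1/2" "1/2"] \<phi>(1)
    by (simp add: cosh_field_def add_divide_distrib[symmetric] \<phi>_def ennreal_mult'[symmetric] mult.commute)
  also have "\<dots> = (\<integral>\<^sup>+w. ennreal ((4 * w\<^sup>2 + K) powr (- (real d + 1) / 2)) \<partial>lborel)"
    by (rule nn_integral_sinh_substitution[symmetric]) measurable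
  also have "\<dots> = ennreal (sqrt K) * (\<integral>\<^sup>+w. ennreal ((4 * (sqrt K * w)\<^sup>2 + K) powr (- (real d + 1) / 2)) \<partial>lborel)"
    using K by (subst nn_integral_real_affine[where c="sqrt K" and t=0]) auto
  also have "\<dots> = ennreal (sqrt K) * (\<integral>\<^sup>+w. ennreal (K powr (- (real d + 1) / 2)) * ennreal ((1 + 4 * w\<^sup>2) powr (- (real d + 1) / 2)) \<partial>lborel)"
  proof -
    have "4 * (sqrt K * w)\<^sup>2 + K = K * (1 + 4 * w\<^sup>2)" for w
      using K by (simp add: power_mult_distrib algebra_simps)
    then show ?thesis using K by (simp add: powr_mult ennreal_mult)
  qed
  also have "\<dots> = ennreal (sqrt K * K powr (- (real d + 1) / 2)) * sinh_const d"
    unfolding sinh_const_def using K by (subst nn_integral_cmult) (auto simp: ennreal_mult mult.assoc)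
  also have "sqrt K * K powr (- (real d + 1) / 2) = K powr (- real d / 2)"
    using K unfolding powr_half_sqrt[symmetric, OF less_imp_le[OF K]] powr_add[symmetric]
    by (simp add: field_simps)
  finally show ?thesis using lin[OF \<alpha> \<beta>] \<alpha> \<beta> by (simp add: \<phi>_def ennreal_mult mult.assoc)
qed

section \<open>The normalising integral of a product of two Poisson kernels\<close>

text \<open>This supplies the condition \<open>2 * norm b < a\<close> for every \<open>t\<close>. It
  follows from the triangle inequality and \<open>(1 - norm z)\<^sup>2 > 0\<close>.\<close>

lemma norm_scaleR_exp_add_less:
  fixes x y :: "'a::euclidean_space"
  assumes x: "norm x < 1" and y: "norm y < 1" and p: "p > 0" and q: "q > 0"
  shows "2 * norm (p *\<^sub>R x + q *\<^sub>R y) < p * (1 + (norm x)\<^sup>2) + q * (1 + (norm y)\<^sup>2)"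
proof -
  have *: "2 * norm z < 1 + (norm z)\<^sup>2" if "norm z < 1" for z :: 'a
  proof -
    have "0 < (1 - norm z)\<^sup>2" using that by simp
    then show ?thesis by (simp add: power2_diff)
  qed
  have "2 * norm (p *\<^sub>R x + q *\<^sub>R y) \<le> 2 * (norm (p *\<^sub>R x) + norm (q *\<^sub>R y))"
    by (intro mult_left_mono norm_triangle_ineq) simp
  also have "\<dots> = p * (2 * norm x) + q * (2 * norm y)" using p q by simp
  also have "\<dots> < p * (1 + (norm x)\<^sup>2) + q * (1 + (norm y)\<^sup>2)"
    using *[OF x] *[OF y] p q by (intro add_strict_mono mult_strict_left_mono)
  finally show ?thesis .
qed

text \<open>The two sides are the double integral over the sphere and \<open>t\<close>, evaluated
  with \<open>t\<close> innermost (Feynman) and with the sphere innermost (ellipsoid). The constants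
  depending on \<open>d\<close> are left unevaluated.\<close>

lemma nn_integral_poisson_product_aux:
  fixes x y :: "'a::euclidean_space"
  assumes x: "norm x < 1" and y: "norm y < 1"
  defines "X \<equiv> 1 - (norm x)\<^sup>2" and "Y \<equiv> 1 - (norm y)\<^sup>2"
    and "W \<equiv> 1 + (norm x)\<^sup>2 * (norm y)\<^sup>2 - 2 * (x \<bullet> y)"
  shows "ennreal ((X * Y) powr (real DIM('a) / 2)) *
      (\<integral>\<^sup>+z. ennreal (1 / (norm (z - x) ^ DIM('a) * norm (z - y) ^ DIM('a))) \<partial>surface_measure) *
      feynman_const DIM('a) =
    ennreal (sphere_area DIM('a) * (((1 + (norm x)\<^sup>2) / X + (1 + (norm y)\<^sup>2) / Y) *
      (4 * W / (X * Y)) powr (- real DIM('a) / 2))) * sinh_const DIM('a)"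
proof -
  define d where "d = DIM('a)"
  have X: "X > 0" and Y: "Y > 0"
    using x y by (auto simp: X_def Y_def abs_square_less_1)
  have "x \<bullet> y \<le> norm x * norm y" by (rule norm_cauchy_schwarz)
  moreover have "norm x * norm y < 1 * 1"
    using x y by (intro mult_strict_mono') auto
  then have "0 < (1 - norm x * norm y)\<^sup>2" by simp
  ultimately have W: "W > 0" by (simp add: W_def power2_diff power_mult_distrib)
  define K where "K = 4 * W / (X * Y)"
  have K: "K > 0" using W X Y by (simp add: K_def)
  \<comment> \<open>\<open>P\<close> and \<open>Q\<close> are affine in \<open>z\<close>, and agree
    with the normalised squared distances to \<open>x\<close> and \<open>y\<close> only where
    \<open>norm z = 1\<close>.\<close>
  define P where "P z = (1 + (norm x)\<^sup>2 - 2 * (x \<bullet> z)) / X" for z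
  define Q where "Q z = (1 + (norm y)\<^sup>2 - 2 * (y \<bullet> z)) / Y" for z
  have [measurable]: "P \<in> borel_measurable borel" "Q \<in> borel_measurable borel"
    unfolding P_def Q_def by measurable
  define \<alpha> where "\<alpha> = (1 + (norm x)\<^sup>2) / X"
  define \<beta> where "\<beta> = (1 + (norm y)\<^sup>2) / Y"
  define b where "b t = (exp t / X) *\<^sub>R x + (exp (-t) / Y) *\<^sub>R y" for t
  define a where "a t = \<alpha> * exp t + \<beta> * exp (-t)" for t
  have ab: "2 * norm (b t) < a t" for t
    using norm_scaleR_exp_add_less[OF x y, of "exp t / X" "exp (-t) / Y"] X Y
    by (simp add: b_def a_def \<alpha>_def \<beta>_def mult_ac)
  have PQ: "exp t * P z + exp (-t) * Q z = a t - 2 * (b t \<bullet> z)" for t z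
    by (simp add: P_def Q_def a_def b_def \<alpha>_def \<beta>_def inner_simps add_divide_distrib diff_divide_distrib algebra_simps)
  \<comment> \<open>The coefficients of \<open>(exp t)\<^sup>2\<close> and
    \<open>(exp (-t))\<^sup>2\<close> are both 1, because
    \<open>(1 + s)\<^sup>2 - 4 * s = (1 - s)\<^sup>2\<close>. The cross terms contribute the
    constant \<open>K - 2\<close>, and the missing \<open>- 2\<close> completes
    \<open>(exp t - exp (-t))\<^sup>2\<close>.\<close>
  have disc: "(a t)\<^sup>2 - 4 * (norm (b t))\<^sup>2 = 4 * (sinh t)\<^sup>2 + K" for t
  proof -
    have e: "exp t * exp (-t) = 1" by (simp add: exp_minus)
    have nb: "(norm (b t))\<^sup>2 = (exp t)\<^sup>2 * ((norm x)\<^sup>2 / X\<^sup>2) + (exp (-t))\<^sup>2 * ((norm y)\<^sup>2 / Y\<^sup>2)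
       + 2 * (exp t * exp (-t)) * (x \<bullet> y) / (X * Y)"
      unfolding power2_norm_eq_inner b_def
      by (simp add: inner_simps inner_commute power2_eq_square add_divide_distrib algebra_simps)
    have aa: "(a t)\<^sup>2 = (exp t)\<^sup>2 * \<alpha>\<^sup>2 + (exp (-t))\<^sup>2 * \<beta>\<^sup>2 + 2 * (exp t * exp (-t)) * (\<alpha> * \<beta>)"
      by (simp add: a_def power2_eq_square algebra_simps)
    have "\<alpha>\<^sup>2 - 4 * ((norm x)\<^sup>2 / X\<^sup>2) = ((1 + (norm x)\<^sup>2)\<^sup>2 - 4 * (norm x)\<^sup>2) / X\<^sup>2"
      by (simp add: \<alpha>_def power_divide diff_divide_distrib)
    also have "(1 + (norm x)\<^sup>2)\<^sup>2 - 4 * (norm x)\<^sup>2 = X\<^sup>2"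
      by (simp add: X_def power2_eq_square algebra_simps)
    finally have ax: "\<alpha>\<^sup>2 = 1 + 4 * ((norm x)\<^sup>2 / X\<^sup>2)" using X by simp
    have "\<beta>\<^sup>2 - 4 * ((norm y)\<^sup>2 / Y\<^sup>2) = ((1 + (norm y)\<^sup>2)\<^sup>2 - 4 * (norm y)\<^sup>2) / Y\<^sup>2"
      by (simp add: \<beta>_def power_divide diff_divide_distrib)
    also have "(1 + (norm y)\<^sup>2)\<^sup>2 - 4 * (norm y)\<^sup>2 = Y\<^sup>2"
      by (simp add: Y_def power2_eq_square algebra_simps)
    finally have ay: "\<beta>\<^sup>2 = 1 + 4 * ((norm y)\<^sup>2 / Y\<^sup>2)" using Y by simp
    have "\<alpha> * \<beta> = (1 + (norm x)\<^sup>2) * (1 + (norm y)\<^sup>2) / (X * Y)"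
      by (simp add: \<alpha>_def \<beta>_def)
    moreover have "2 = 2 * X * Y / (X * Y)" using X Y by simp
    ultimately have "2 * (\<alpha> * \<beta>) - 8 * (x \<bullet> y) / (X * Y) + 2 =
       (2 * (1 + (norm x)\<^sup>2) * (1 + (norm y)\<^sup>2) - 8 * (x \<bullet> y) + 2 * X * Y) / (X * Y)"
      by (simp only: add_divide_distrib diff_divide_distrib times_divide_eq_right mult.assoc)
    also have "2 * (1 + (norm x)\<^sup>2) * (1 + (norm y)\<^sup>2) - 8 * (x \<bullet> y) + 2 * X * Y = 4 * W"
      by (simp add: X_def Y_def W_def algebra_simps)
    finally have k: "2 * (\<alpha> * \<beta>) - 8 * (x \<bullet> y) / (X * Y) = K - 2" by (simp add: K_def)
    have "4 * (sinh t)\<^sup>2 = (exp t - exp (-t))\<^sup>2"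
      by (simp add: sinh_field_def power_divide)
    also have "\<dots> = (exp t)\<^sup>2 + (exp (-t))\<^sup>2 - 2"
      using e by (simp add: power2_diff)
    finally have s: "4 * (sinh t)\<^sup>2 = (exp t)\<^sup>2 + (exp (-t))\<^sup>2 - 2" .
    show ?thesis
      unfolding aa nb e s ax ay using k by (simp add: algebra_simps)
  qed
  have sph: "ennreal ((X * Y) powr (real d / 2)) * ennreal (1 / (norm (z - x) ^ d * norm (z - y) ^ d)) *
     feynman_const d = (\<integral>\<^sup>+t. ennreal (1 / (exp t * P z + exp (-t) * Q z) ^ d) \<partial>lborel)"
    if z: "z \<in> space surface_measure" for z
  proof -
    have nz: "norm z = 1" using z by (simp add: space_surface_measure)
    have "z \<noteq> x" "z \<noteq> y" using nz x y by auto
    then have pos: "norm (z - x) > 0" "norm (z - y) > 0" by auto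
    have zz: "z \<bullet> z = 1" using nz by (simp add: norm_eq_1)
    have P: "P z = (norm (z - x))\<^sup>2 / X" and Q: "Q z = (norm (z - y))\<^sup>2 / Y"
      by (simp_all add: P_def Q_def power2_norm_eq_inner inner_simps inner_commute zz)
    have pw: "(u\<^sup>2) powr (- real d / 2) = 1 / u ^ d" if "u > 0" for u :: real
    proof -
      have "(u\<^sup>2) powr (- real d / 2) = (u powr 2) powr (- real d / 2)"
        using that by (simp add: powr_numeral)
      also have "\<dots> = u powr (- real d)" by (simp add: powr_powr)
      also have "\<dots> = 1 / u ^ d" using that by (simp add: powr_minus_divide powr_realpow)
      finally show ?thesis .
    qed
    have "P z * Q z = (norm (z - x))\<^sup>2 * (norm (z - y))\<^sup>2 / (X * Y)" by (simp add: P Q)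
    then have "(P z * Q z) powr (- real d / 2) =
        ((norm (z - x))\<^sup>2) powr (- real d / 2) * ((norm (z - y))\<^sup>2) powr (- real d / 2) / (X * Y) powr (- real d / 2)"
      using X Y by (simp add: powr_divide powr_mult)
    also have "\<dots> = (X * Y) powr (real d / 2) * (1 / (norm (z - x) ^ d * norm (z - y) ^ d))"
      unfolding pw[OF pos(1)] pw[OF pos(2)] by (simp add: powr_minus_divide)
    finally have e: "(P z * Q z) powr (- real d / 2) =
        (X * Y) powr (real d / 2) * (1 / (norm (z - x) ^ d * norm (z - y) ^ d))" .
    have "P z > 0" "Q z > 0" using pos X Y by (auto simp: P Q)
    then have "(\<integral>\<^sup>+t. ennreal (1 / (exp t * P z + exp (-t) * Q z) ^ d) \<partial>lborel) =
        ennreal ((P z * Q z) powr (- real d / 2)) * feynman_const d"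
      by (rule nn_integral_feynman)
    moreover have "ennreal ((X * Y) powr (real d / 2)) * ennreal (1 / (norm (z - x) ^ d * norm (z - y) ^ d)) =
        ennreal ((P z * Q z) powr (- real d / 2))"
      unfolding e by (rule ennreal_mult[symmetric]) auto
    ultimately show ?thesis by simp
  qed
  have m: "(\<lambda>z. ennreal (1 / (norm (z - x) ^ d * norm (z - y) ^ d))) \<in> borel_measurable surface_measure"
    by (rule measurable_surface_measure) measurable
  have "ennreal ((X * Y) powr (real d / 2)) *
      (\<integral>\<^sup>+z. ennreal (1 / (norm (z - x) ^ d * norm (z - y) ^ d)) \<partial>surface_measure) * feynman_const d =
    (\<integral>\<^sup>+z. ennreal ((X * Y) powr (real d / 2)) * ennreal (1 / (norm (z - x) ^ d * norm (z - y) ^ d)) * feynman_const d \<partial>surface_measure)"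
    using m by (simp add: nn_integral_multc nn_integral_cmult)
  also have "\<dots> = (\<integral>\<^sup>+z. (\<integral>\<^sup>+t. ennreal (1 / (exp t * P z + exp (-t) * Q z) ^ d) \<partial>lborel) \<partial>surface_measure)"
    by (rule nn_integral_cong) (rule sph)
  also have "\<dots> = (\<integral>\<^sup>+t. (\<integral>\<^sup>+z. ennreal (1 / (exp t * P z + exp (-t) * Q z) ^ d) \<partial>surface_measure) \<partial>lborel)"
    by (rule nn_integral_surface_measure_swap) (simp add: split_beta')
  also have "\<dots> = (\<integral>\<^sup>+t. ennreal (sphere_area d) * ennreal (a t * (4 * (sinh t)\<^sup>2 + K) powr (- (real d + 1) / 2)) \<partial>lborel)"
  proof (rule nn_integral_cong)
    fix t :: real
    have "a t > 0" using ab[of t] norm_ge_zero[of "b t"] by linarith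
    then show "(\<integral>\<^sup>+z. ennreal (1 / (exp t * P z + exp (-t) * Q z) ^ d) \<partial>surface_measure) =
      ennreal (sphere_area d) * ennreal (a t * (4 * (sinh t)\<^sup>2 + K) powr (- (real d + 1) / 2))"
      unfolding PQ disc[symmetric] d_def
      by (subst nn_integral_surface_measure_affine[OF ab]) (simp add: ennreal_mult'')
  qed
  also have "\<dots> = ennreal (sphere_area d) * (ennreal ((\<alpha> + \<beta>) * K powr (- real d / 2)) * sinh_const d)"
  proof -
    have [measurable]: "sinh \<in> borel_measurable (borel :: real measure)"
      by (auto intro!: borel_measurable_continuous_onI continuous_intros)
    have "\<alpha> \<ge> 0" "\<beta> \<ge> 0" using X Y by (auto simp: \<alpha>_def \<beta>_def)
    then have "ennreal ((\<alpha> + \<beta>) * K powr (- real d / 2)) * sinh_const d =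
        (\<integral>\<^sup>+t. ennreal (a t * (4 * (sinh t)\<^sup>2 + K) powr (- (real d + 1) / 2)) \<partial>lborel)"
      unfolding a_def by (rule nn_integral_exp_sinh_powr[OF K, symmetric])
    then show ?thesis unfolding a_def by (simp only:) (intro nn_integral_cmult, measurable)
  qed
  also have "\<dots> = ennreal (sphere_area d * ((\<alpha> + \<beta>) * K powr (- real d / 2))) * sinh_const d"
    using X Y by (subst ennreal_mult'') (auto simp: mult.assoc \<alpha>_def \<beta>_def)
  finally show ?thesis by (simp only: d_def \<alpha>_def \<beta>_def K_def)
qed

lemma sphere_area_pos: "d > 0 \<Longrightarrow> sphere_area d > 0"
  unfolding sphere_area_def by (intro divide_pos_pos mult_pos_pos Gamma_real_pos) auto

text \<open>Comparing the preceding identity with its instance at \<open>x = y = 0\<close>, where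
  the integral is the area of the sphere, removes the unevaluated constants.\<close>

lemma nn_integral_poisson_product:
  fixes x y :: "'a::euclidean_space"
  assumes x: "norm x < 1" and y: "norm y < 1"
  shows "(\<integral>\<^sup>+z. ennreal (1 / (norm (z - x) ^ DIM('a) * norm (z - y) ^ DIM('a))) \<partial>surface_measure) =
    ennreal (sphere_area DIM('a) * ((1 - (norm x)\<^sup>2 * (norm y)\<^sup>2) / ((1 - (norm x)\<^sup>2) * (1 - (norm y)\<^sup>2))) *
      (1 + (norm x)\<^sup>2 * (norm y)\<^sup>2 - 2 * (x \<bullet> y)) powr (- real DIM('a) / 2))"
  (is "?I = _")
proof -
  define d where "d = DIM('a)"
  have d: "d > 0" by (simp add: d_def)
  define A where "A = sphere_area d"
  define C where "C = feynman_const d"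
  define H where "H = sinh_const d"
  have A: "A > 0" using sphere_area_pos[OF d] by (simp add: A_def)
  have C: "C \<noteq> 0" "C \<noteq> \<infinity>"
    using feynman_const_pos[of d] feynman_const_finite[OF d] by (auto simp: C_def)
  define X where "X = 1 - (norm x)\<^sup>2"
  define Y where "Y = 1 - (norm y)\<^sup>2"
  define W where "W = 1 + (norm x)\<^sup>2 * (norm y)\<^sup>2 - 2 * (x \<bullet> y)"
  have X: "X > 0" and Y: "Y > 0"
    using x y by (auto simp: X_def Y_def abs_square_less_1)
  \<comment> \<open>Half of \<open>G\<close> is the rational factor of the claimed value.\<close>
  define G where "G = (1 + (norm x)\<^sup>2) / X + (1 + (norm y)\<^sup>2) / Y"
  have "G * (X * Y) = (1 + (norm x)\<^sup>2) * Y + (1 + (norm y)\<^sup>2) * X"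
    using X Y by (simp add: G_def field_simps)
  also have "\<dots> = 2 * (1 - (norm x)\<^sup>2 * (norm y)\<^sup>2)" by (simp add: X_def Y_def algebra_simps)
  finally have G: "G / 2 = (1 - (norm x)\<^sup>2 * (norm y)\<^sup>2) / (X * Y)" using X Y by (simp add: field_simps)
  have "1 + (norm z)\<^sup>2 > 0" for z :: 'a using zero_le_power2[of "norm z"] by linarith
  then have Gp: "G > 0" using X Y by (simp add: G_def add_pos_pos)
  have one: "(\<integral>\<^sup>+z. ennreal (1 / (norm (z - 0 :: 'a) ^ d * norm (z - 0) ^ d)) \<partial>surface_measure) = ennreal A"
  proof -
    have "(\<integral>\<^sup>+z. ennreal (1 / (norm (z - 0 :: 'a) ^ d * norm (z - 0) ^ d)) \<partial>surface_measure) =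
      (\<integral>\<^sup>+z. ennreal (1 / (1 - 2 * ((0::'a) \<bullet> z)) ^ d) \<partial>surface_measure)"
      by (rule nn_integral_cong) (simp add: space_surface_measure)
    also have "\<dots> = ennreal A"
      unfolding d_def A_def by (subst nn_integral_surface_measure_affine) auto
    finally show ?thesis .
  qed
  \<comment> \<open>At the origin \<open>X = Y = W = 1\<close> and \<open>G = 2\<close>, so this
    relates \<open>C\<close> and \<open>H\<close> directly.\<close>
  have base: "ennreal A * C = ennreal (A * (2 * 4 powr (- real d / 2))) * H"
    using nn_integral_poisson_product_aux[of "0::'a" 0] one
    by (simp add: d_def[symmetric] A_def[symmetric] C_def[symmetric] H_def[symmetric])
  have main: "ennreal ((X * Y) powr (real d / 2)) * ?I * C =
     ennreal (A * (G * (4 * W / (X * Y)) powr (- real d / 2))) * H"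
    using nn_integral_poisson_product_aux[OF x y]
    by (simp only: d_def[symmetric] A_def[symmetric] C_def[symmetric] H_def[symmetric]
         X_def[symmetric] Y_def[symmetric] W_def[symmetric] G_def[symmetric])
  \<comment> \<open>\<open>r\<close> is the factor by which the coefficient of \<open>H\<close> in
    \<open>main\<close> exceeds the one in \<open>base\<close>.\<close>
  define r where "r = G / 2 * (W / (X * Y)) powr (- real d / 2)"
  have r: "r \<ge> 0" using Gp by (simp add: r_def)
  have W0: "W \<ge> 0"
  proof -
    have "x \<bullet> y \<le> norm x * norm y" by (rule norm_cauchy_schwarz)
    moreover have "0 \<le> (1 - norm x * norm y)\<^sup>2" by simp
    ultimately show ?thesis by (simp add: W_def power2_diff power_mult_distrib)
  qed
  have "(4 * W / (X * Y)) powr (- real d / 2) = 4 powr (- real d / 2) * (W / (X * Y)) powr (- real d / 2)"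
    unfolding times_divide_eq_right[symmetric] using X Y W0 by (intro powr_mult)
  then have eq: "A * (G * (4 * W / (X * Y)) powr (- real d / 2)) = r * (A * (2 * 4 powr (- real d / 2)))"
    by (simp add: r_def)
  have "ennreal (r * (A * (2 * 4 powr (- real d / 2)))) = ennreal r * ennreal (A * (2 * 4 powr (- real d / 2)))"
    using r A by (intro ennreal_mult) auto
  then have "ennreal ((X * Y) powr (real d / 2)) * ?I * C = ennreal r * (ennreal (A * (2 * 4 powr (- real d / 2))) * H)"
    unfolding main eq by (simp only: mult.assoc)
  \<comment> \<open>\<open>H\<close> disappears by substituting \<open>base\<close>; then
    \<open>C\<close>, being nonzero and finite, is cancelled.\<close>
  also have "\<dots> = (ennreal r * ennreal A) * C" by (simp only: base[symmetric] mult.assoc)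
  finally have "C * (ennreal ((X * Y) powr (real d / 2)) * ?I) = C * (ennreal r * ennreal A)"
    unfolding mult.commute[of C] .
  then have "ennreal ((X * Y) powr (real d / 2)) * ?I = ennreal r * ennreal A"
    using C by (simp add: ennreal_mult_cancel_left)
  then have "ennreal ((X * Y) powr (- real d / 2)) * (ennreal ((X * Y) powr (real d / 2)) * ?I) =
     ennreal ((X * Y) powr (- real d / 2)) * (ennreal r * ennreal A)" by simp
  moreover have "(X * Y) powr (- real d / 2) * (X * Y) powr (real d / 2) = 1"
    using X Y by (simp add: powr_add[symmetric])
  ultimately have "?I = ennreal ((X * Y) powr (- real d / 2)) * (ennreal r * ennreal A)"
    by (simp add: mult.assoc[symmetric] ennreal_mult[symmetric])
  also have "\<dots> = ennreal ((X * Y) powr (- real d / 2) * (r * A))"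
    using r A by (simp add: ennreal_mult)
  also have "(X * Y) powr (- real d / 2) * (r * A) = A * (G / 2) * W powr (- real d / 2)"
    using X Y W0 by (simp add: r_def powr_divide)
  finally show ?thesis
    by (simp only: G X_def Y_def W_def A_def d_def)
qed

section \<open>Bayes' formula with the evaluated normalising constant\<close>

theorem theorem11:
  fixes \<eta>\<^sub>1 \<eta>\<^sub>2 \<xi> :: "'a::euclidean_space" and \<rho>\<^sub>1 \<rho>\<^sub>2 :: real
  assumes "DIM('a) \<ge> 2"
    and "0 \<le> \<rho>\<^sub>1" "\<rho>\<^sub>1 < 1" "0 \<le> \<rho>\<^sub>2" "\<rho>\<^sub>2 < 1"
    and "\<eta>\<^sub>1 \<in> sphere 0 1" "\<eta>\<^sub>2 \<in> sphere 0 1" "\<xi> \<in> sphere 0 1"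
  shows "posterior_density \<rho>\<^sub>1 \<rho>\<^sub>2 \<eta>\<^sub>2 \<eta>\<^sub>1 \<xi> =
     (1 / sphere_area DIM('a)) *
     ((1 + \<rho>\<^sub>1\<^sup>2 * \<rho>\<^sub>2\<^sup>2 - 2 * \<rho>\<^sub>1 * \<rho>\<^sub>2 * (\<eta>\<^sub>1 \<bullet> \<eta>\<^sub>2)) powr (real DIM('a) / 2)
        / (1 - \<rho>\<^sub>1\<^sup>2 * \<rho>\<^sub>2\<^sup>2)) *
     ((1 - \<rho>\<^sub>1\<^sup>2) / norm (\<xi> - \<rho>\<^sub>1 *\<^sub>R \<eta>\<^sub>1) ^ DIM('a)) *
     ((1 - \<rho>\<^sub>2\<^sup>2) / norm (\<xi> - \<rho>\<^sub>2 *\<^sub>R \<eta>\<^sub>2) ^ DIM('a))"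
proof -
  define d where "d = DIM('a)"
  define A where "A = sphere_area d"
  define X where "X = 1 - \<rho>\<^sub>1\<^sup>2"
  define Y where "Y = 1 - \<rho>\<^sub>2\<^sup>2"
  define V where "V = 1 - \<rho>\<^sub>1\<^sup>2 * \<rho>\<^sub>2\<^sup>2"
  define W where "W = 1 + \<rho>\<^sub>1\<^sup>2 * \<rho>\<^sub>2\<^sup>2 - 2 * \<rho>\<^sub>1 * \<rho>\<^sub>2 * (\<eta>\<^sub>1 \<bullet> \<eta>\<^sub>2)"
  define x where "x = \<rho>\<^sub>1 *\<^sub>R \<eta>\<^sub>1"
  define y where "y = \<rho>\<^sub>2 *\<^sub>R \<eta>\<^sub>2"
  have A: "A > 0" by (simp add: A_def d_def sphere_area_pos)
  have nx: "norm x = \<rho>\<^sub>1" "norm x < 1" and ny: "norm y = \<rho>\<^sub>2" "norm y < 1"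
    using assms by (auto simp: x_def y_def)
  have X: "X > 0" and Y: "Y > 0"
    using assms by (auto simp: X_def Y_def abs_square_less_1)
  \<comment> \<open>Both squared norms expand to \<open>1 + \<rho>\<^sub>1\<^sup>2 - 2 *
    \<rho>\<^sub>1 * (\<eta>\<^sub>1 \<bullet> z)\<close>, so the likelihood is a Poisson kernel in
    the parameter.\<close>
  have swap: "norm (\<eta>\<^sub>1 - \<rho>\<^sub>1 *\<^sub>R z) = norm (z - x)" if "norm z = 1" for z
  proof -
    have "(norm (\<eta>\<^sub>1 - \<rho>\<^sub>1 *\<^sub>R z))\<^sup>2 = (norm (z - x))\<^sup>2"
      using that assms(6) unfolding power2_norm_eq_inner
      by (simp add: x_def inner_simps inner_commute norm_eq_1)
    then show ?thesis by simp
  qed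
  have dens: "exit_density \<rho>\<^sub>1 z \<eta>\<^sub>1 * exit_density \<rho>\<^sub>2 \<eta>\<^sub>2 z =
      X * Y / A\<^sup>2 * (1 / (norm (z - x) ^ d * norm (z - y) ^ d))" if "norm z = 1" for z
    unfolding exit_density_def swap[OF that] d_def[symmetric] A_def[symmetric] X_def[symmetric]
      Y_def[symmetric] y_def[symmetric] by (simp add: power2_eq_square)
  have m: "(\<lambda>z. 1 / (norm (z - x) ^ d * norm (z - y) ^ d)) \<in> borel_measurable surface_measure"
    by (rule measurable_surface_measure) measurable
  have xy: "1 + (norm x)\<^sup>2 * (norm y)\<^sup>2 - 2 * (x \<bullet> y) = W"
    by (simp add: nx ny W_def) (simp add: x_def y_def)
  have "\<rho>\<^sub>1\<^sup>2 * \<rho>\<^sub>2\<^sup>2 < 1 * 1"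
    using assms by (intro mult_strict_mono') (auto simp: abs_square_less_1)
  then have V: "V > 0" by (simp add: V_def)
  have "(\<integral>z. exit_density \<rho>\<^sub>1 z \<eta>\<^sub>1 * exit_density \<rho>\<^sub>2 \<eta>\<^sub>2 z \<partial>surface_measure) =
    (\<integral>z. X * Y / A\<^sup>2 * (1 / (norm (z - x) ^ d * norm (z - y) ^ d)) \<partial>surface_measure)"
    by (intro Bochner_Integration.integral_cong refl dens) (simp add: space_surface_measure)
  also have "\<dots> = X * Y / A\<^sup>2 * (\<integral>z. 1 / (norm (z - x) ^ d * norm (z - y) ^ d) \<partial>surface_measure)"
    by (rule integral_mult_right_zero)
  \<comment> \<open>The integrand is nonnegative and measurable, so the Bochner integral is the real
    value of the nonnegative integral, which is finite.\<close>
  also have "(\<integral>z. 1 / (norm (z - x) ^ d * norm (z - y) ^ d) \<partial>surface_measure) =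
     A * (V / (X * Y)) * W powr (- real d / 2)"
    unfolding integral_eq_nn_integral[OF m AE_I2, simplified]
    using nn_integral_poisson_product[OF nx(2) ny(2)] A X Y V
    unfolding xy unfolding nx ny d_def[symmetric] A_def[symmetric] X_def[symmetric] Y_def[symmetric] V_def[symmetric]
    by simp
  also have "X * Y / A\<^sup>2 * (A * (V / (X * Y)) * W powr (- real d / 2)) = V / (A * W powr (real d / 2))"
    using X Y A by (simp add: power2_eq_square powr_minus_divide)
  finally have int: "(\<integral>z. exit_density \<rho>\<^sub>1 z \<eta>\<^sub>1 * exit_density \<rho>\<^sub>2 \<eta>\<^sub>2 z \<partial>surface_measure) =
     V / (A * W powr (real d / 2))" .
  have "norm \<xi> = 1" using assms by simp
  then show ?thesis
    unfolding posterior_density_def int dens[OF \<open>norm \<xi> = 1\<close>] 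
      d_def[symmetric] A_def[symmetric] X_def[symmetric] Y_def[symmetric] V_def[symmetric]
      W_def[symmetric] x_def[symmetric] y_def[symmetric]
    using A by (simp add: power2_eq_square mult_ac)
qed

end
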